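(* Let $k$ and $c$ be positive integers, let $f(k,c) = 8k^{2}c + 10kc - 4k + 2c + 1$, and let $G$ be a finite simple graph of order $n \ge f(k,c)$. Suppose that $G$ contains $k$ pairwise vertex-disjoint $c$-chorded cycles. If $\sigma_{2}(G) \ge n$, then $G$ can be partitioned into $k$ $c$-chorded cycles, i.e., $G$ contains $k$ pairwise vertex-disjoint $c$-chorded cycles whose vertex sets cover $V(G)$.
   Context: For a graph $G$, $\sigma_{2}(G)$ denotes the minimum of $d_{G}(u)+d_{G}(v)$ over all pairs of distinct non-adjacent vertices $u,v$ of $G$; if $G$ is complete, $\sigma_{2}(G)=+\infty$. For an integer $c \ge 1$, a cycle $C$ in $G$ is a $c$-chorded cycle if $|E(G[V(C)]) \setminus E(C)| \ge c$, where $G[X]$ is the subgraph induced by $X$; edges of $E(G[V(C)]) \setminus E(C)$ are called chords of $C$. *)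

theory Defs
  imports Main "HOL-Library.Extended_Nat"
begin

definition simple_graph :: "'a set \<Rightarrow> 'a set set \<Rightarrow> bool" where
  "simple_graph V E \<longleftrightarrow> finite V \<and> (\<forall>e\<in>E. \<exists>u v. u \<in> V \<and> v \<in> V \<and> u \<noteq> v \<and> e = {u, v})"

definition degree :: "'a set \<Rightarrow> 'a set set \<Rightarrow> 'a \<Rightarrow> nat" where
  "degree V E u = card {v \<in> V. {u, v} \<in> E}"

definition sigma2 :: "'a set \<Rightarrow> 'a set set \<Rightarrow> enat" where
  "sigma2 V E =
     (if \<not> (\<exists>u\<in>V. \<exists>v\<in>V. u \<noteq> v \<and> {u, v} \<notin> E) then \<infinity>
      else Min {enat (degree V E u + degree V E v) | u v. u \<in> V \<and> v \<in> V \<and> u \<noteq> v \<and> {u, v} \<notin> E})"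

definition cycle_edges :: "'a list \<Rightarrow> 'a set set" where
  "cycle_edges C = {{C ! i, C ! ((i + 1) mod length C)} | i. i < length C}"

definition is_cycle :: "'a set \<Rightarrow> 'a set set \<Rightarrow> 'a list \<Rightarrow> bool" where
  "is_cycle V E C \<longleftrightarrow> length C \<ge> 3 \<and> distinct C \<and> set C \<subseteq> V \<and> cycle_edges C \<subseteq> E"

definition chords :: "'a set set \<Rightarrow> 'a list \<Rightarrow> 'a set set" where
  "chords E C = {e \<in> E. e \<subseteq> set C} - cycle_edges C"

definition c_chorded_cycle :: "nat \<Rightarrow> 'a set \<Rightarrow> 'a set set \<Rightarrow> 'a list \<Rightarrow> bool" where
  "c_chorded_cycle c V E C \<longleftrightarrow> is_cycle V E C \<and> card (chords E C) \<ge> c"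

definition disjoint_chorded_cycles :: "nat \<Rightarrow> nat \<Rightarrow> 'a set \<Rightarrow> 'a set set \<Rightarrow> 'a list list \<Rightarrow> bool" where
  "disjoint_chorded_cycles k c V E Cs \<longleftrightarrow> length Cs = k \<and>
     (\<forall>i<k. c_chorded_cycle c V E (Cs ! i)) \<and>
     (\<forall>i<k. \<forall>j<k. i \<noteq> j \<longrightarrow> set (Cs ! i) \<inter> set (Cs ! j) = {})"

definition f_bound :: "nat \<Rightarrow> nat \<Rightarrow> nat" where
  "f_bound k c = 8 * k^2 * c + 10 * k * c + 2 * c + 1 - 4 * k"

end

theory Submission
  imports Defs
begin

text \<open>
  The existence of a \<open>c\<close>-chorded cycle through exactly the vertices of \<open>X\<close> only means that \<open>X\<close> is
  Hamiltonian and spans at least \<open>|X| + c\<close> edges, a property inherited by every larger Hamiltonian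
  set. For \<open>k = 1\<close> Ore's theorem finishes the proof. For \<open>k \<ge> 2\<close> choose a packing of maximal
  coverage and let \<open>H\<close> be the set of uncovered vertices. No \<open>y \<in> H\<close> can be inserted into a cycle,
  so \<open>y\<close> has at most \<open>|X| / 2\<close> neighbours in each cycle \<open>X\<close>, and \<open>H\<close> inherits Ore's condition.

  Consider a path that runs through a cycle \<open>X\<close> and then into \<open>H\<close>, ending in \<open>y\<close>. If its ends have
  too small a degree sum on the path to close it up, then its first vertex has more than half of some
  other cycle as neighbours and can be inserted there. Repeating this eventually closes
  the path, and the new cycle contains all neighbours of \<open>y\<close> in \<open>X\<close>. Hence \<open>y\<close> has at most \<open>c + 1\<close>
  neighbours in \<open>X\<close>; and if \<open>|H| \<ge> 2c + 3\<close>, then \<open>H\<close> itself carries a \<open>c\<close>-chorded cycle and can be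
  merged with some \<open>X\<close>, contradicting maximality. Otherwise \<open>y\<close> has degree at most
  \<open>d = k(c + 1) + 2c + 1\<close>, so all vertices outside the closed neighbourhood of \<open>y\<close> have degree at least
  \<open>n - d\<close>. Cutting a Hamiltonian cycle of the graph into \<open>k\<close> segments of length at least
  \<open>2d\<close> whose ends are such vertices gives the partition.
\<close>

section \<open>Graphs, degrees into vertex sets, packings\<close>

locale graph =
  fixes V :: "'a set" and E :: "'a set set" and c :: nat
  assumes simple: "simple_graph V E"
begin

definition adj :: "'a \<Rightarrow> 'a \<Rightarrow> bool" where
  "adj u v \<longleftrightarrow> {u, v} \<in> E"

definition deg :: "'a set \<Rightarrow> 'a \<Rightarrow> nat" where
  "deg X u = card {v \<in> X. adj u v}"

definition path :: "'a list \<Rightarrow> bool" where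
  "path xs \<longleftrightarrow> distinct xs \<and> successively adj xs"

definition closed_path :: "'a list \<Rightarrow> bool" where
  "closed_path xs \<longleftrightarrow> path xs \<and> 3 \<le> length xs \<and> adj (last xs) (hd xs)"

definition ham :: "'a set \<Rightarrow> bool" where
  "ham X \<longleftrightarrow> (\<exists>xs. closed_path xs \<and> set xs = X)"

definition induced :: "'a set \<Rightarrow> 'a set set" where
  "induced X = {e \<in> E. e \<subseteq> X}"

text \<open>A Hamiltonian cycle of \<open>X\<close> uses exactly \<open>card X\<close> edges, so the
  inequality demands at least \<open>c\<close> chords without reference to a particular
  cycle.\<close>

definition good :: "'a set \<Rightarrow> bool" where
  "good X \<longleftrightarrow> ham X \<and> card X + c \<le> card (induced X)"

definition packing :: "nat \<Rightarrow> 'a set set \<Rightarrow> bool" where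
  "packing m D \<longleftrightarrow> finite D \<and> card D = m \<and> pairwise disjnt D \<and> (\<forall>X\<in>D. good X \<and> X \<subseteq> V)"

lemma finite_V: "finite V"
  using simple by (simp add: simple_graph_def)

lemma finite_E: "finite E"
proof (rule finite_subset)
  show "E \<subseteq> Pow V" using simple by (auto simp: simple_graph_def)
qed (simp add: finite_V)

lemma finite_induced: "finite (induced X)"
  by (simp add: induced_def finite_E)

lemma adj_sym: "adj u v \<longleftrightarrow> adj v u"
  by (simp add: adj_def insert_commute)

lemma adj_irrefl [simp]: "\<not> adj u u"
  using simple by (force simp: adj_def simple_graph_def doubleton_eq_iff)

lemma deg_mono: "finite Y \<Longrightarrow> X \<subseteq> Y \<Longrightarrow> deg X u \<le> deg Y u"
  unfolding deg_def by (rule card_mono) auto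

lemma deg_le_card: "finite X \<Longrightarrow> deg X u \<le> card X"
  unfolding deg_def by (rule card_mono) auto

lemma deg_less_card: "finite X \<Longrightarrow> u \<in> X \<Longrightarrow> deg X u < card X"
  unfolding deg_def by (rule psubset_card_mono) (simp, use adj_irrefl in blast)

lemma deg_Un_disjoint:
  assumes "finite X" "finite Y" "X \<inter> Y = {}"
  shows "deg (X \<union> Y) u = deg X u + deg Y u"
proof -
  have "{v \<in> X \<union> Y. adj u v} = {v \<in> X. adj u v} \<union> {v \<in> Y. adj u v}" by auto
  then show ?thesis unfolding deg_def using assms by (simp add: card_Un_disjoint disjoint_iff)
qed

lemma deg_Union:
  assumes "finite D" "pairwise disjnt D" "\<And>X. X \<in> D \<Longrightarrow> finite X"
  shows "deg (\<Union>D) u = (\<Sum>X\<in>D. deg X u)"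
proof -
  have "{v \<in> \<Union>D. adj u v} = (\<Union>X\<in>D. {v \<in> X. adj u v})" by auto
  also have "card \<dots> = (\<Sum>X\<in>D. card {v \<in> X. adj u v})"
    using assms by (intro card_UN_disjoint) (auto simp: pairwise_def disjnt_def)
  finally show ?thesis by (simp add: deg_def)
qed

text \<open>Pigeonhole: two neighbourhoods inside \<open>X\<close> of total size above
  \<open>card X\<close> must overlap.\<close>

lemma common_neighbour:
  assumes "finite X" "card X < deg X u + deg X v"
  obtains z where "z \<in> X" "adj u z" "adj v z"
proof -
  have "card ({z \<in> X. adj u z} \<union> {z \<in> X. adj v z}) \<le> card X"
    using assms(1) by (intro card_mono) auto
  then have "{z \<in> X. adj u z} \<inter> {z \<in> X. adj v z} \<noteq> {}"
    using assms card_Un_disjoint[of "{z \<in> X. adj u z}" "{z \<in> X. adj v z}"]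
    by (auto simp: deg_def)
  then show ?thesis using that by blast
qed

section \<open>Paths, rotation and closing up to cycles\<close>

lemma path_rev: "path (rev xs) \<longleftrightarrow> path xs"
  by (auto simp: path_def adj_sym elim!: successively_mono)

lemma closed_path_rotate: "closed_path (xs @ ys) \<Longrightarrow> closed_path (ys @ xs)"
  by (cases "xs = []"; cases "ys = []")
     (auto simp: closed_path_def path_def successively_append_iff)

lemma ham_hd:
  assumes "ham X" "p \<in> X"
  obtains xs where "closed_path (p # xs)" "set (p # xs) = X"
proof -
  obtain zs where zs: "closed_path zs" "set zs = X" using assms by (auto simp: ham_def)
  then obtain as bs where "zs = as @ p # bs" using assms(2) by (metis split_list)
  then show ?thesis using that[of "bs @ as"] zs closed_path_rotate[of as "p # bs"] by auto
qed

lemma ham_last: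
  assumes "ham X" "p \<in> X"
  obtains xs where "closed_path (xs @ [p])" "set (xs @ [p]) = X"
proof -
  obtain xs where "closed_path (p # xs)" "set (p # xs) = X" using ham_hd[OF assms] .
  then show ?thesis using that[of xs] closed_path_rotate[of "[p]" xs] by auto
qed

lemma ham_card: "ham X \<Longrightarrow> 3 \<le> card X"
  by (auto simp: ham_def closed_path_def path_def distinct_card)

lemma ham_finite: "ham X \<Longrightarrow> finite X"
  by (auto simp: ham_def)

text \<open>The crossing argument of Dirac and Ore: some edge of the path has its right end adjacent
  to the head and its left end adjacent to the last vertex, and exchanging it for these two edges
  yields a cycle.\<close>

lemma path_crossing:
  assumes "path xs" "3 \<le> length xs"
    and deg: "length xs \<le> deg (set xs) (hd xs) + deg (set xs) (last xs)"
  shows "ham (set xs)"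
proof -
  let ?m = "length xs"
  have dist: "distinct xs" and succ: "successively adj xs"
    using assms(1) by (auto simp: path_def)
  have ne: "xs \<noteq> []" using assms(2) by auto
  \<comment> \<open>Neighbours of the head are recorded one position to the left. Both index sets
    then lie among \<open>length xs - 1\<close> positions, too few for them to be disjoint.\<close>
  define A where "A = {i. Suc i < ?m \<and> adj (hd xs) (xs ! Suc i)}"
  define B where "B = {i. Suc i < ?m \<and> adj (last xs) (xs ! i)}"
  have sub: "A \<union> B \<subseteq> {..<?m - 1}" by (auto simp: A_def B_def)
  then have fin: "finite A" "finite B" using finite_subset by auto
  have "{v \<in> set xs. adj (hd xs) v} = (\<lambda>i. xs ! Suc i) ` A"
  proof (intro equalityI subsetI)
    fix v assume "v \<in> {v \<in> set xs. adj (hd xs) v}"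
    then obtain j where j: "j < ?m" "v = xs ! j" "adj (hd xs) v" by (auto simp: in_set_conv_nth)
    then have "j \<noteq> 0" using ne by (metis adj_irrefl hd_conv_nth)
    then obtain i where "j = Suc i" using not0_implies_Suc by blast
    then show "v \<in> (\<lambda>i. xs ! Suc i) ` A" using j by (auto simp: A_def)
  qed (auto simp: A_def)
  then have cA: "deg (set xs) (hd xs) \<le> card A"
    using fin by (simp add: deg_def card_image_le)
  have "{v \<in> set xs. adj (last xs) v} = (\<lambda>i. xs ! i) ` B"
  proof (intro equalityI subsetI)
    fix v assume "v \<in> {v \<in> set xs. adj (last xs) v}"
    then obtain j where j: "j < ?m" "v = xs ! j" "adj (last xs) v" by (auto simp: in_set_conv_nth)
    then have "j \<noteq> ?m - 1" using ne by (metis adj_irrefl last_conv_nth)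
    then show "v \<in> (\<lambda>i. xs ! i) ` B" using j by (auto simp: B_def)
  qed (auto simp: B_def)
  then have cB: "deg (set xs) (last xs) \<le> card B"
    using fin by (simp add: deg_def card_image_le)
  have "A \<inter> B \<noteq> {}"
  proof
    assume "A \<inter> B = {}"
    then have "card A + card B = card (A \<union> B)" using fin by (simp add: card_Un_disjoint)
    also have "\<dots> \<le> ?m - 1" using card_mono[OF _ sub] by simp
    finally show False using deg cA cB assms(2) by linarith
  qed
  then obtain i where i: "Suc i < ?m" "adj (hd xs) (xs ! Suc i)" "adj (last xs) (xs ! i)"
    by (auto simp: A_def B_def)
  define ps qs where "ps = take (Suc i) xs" and "qs = drop (Suc i) xs"
  have xs: "xs = ps @ qs" by (simp add: ps_def qs_def)
  have "ps \<noteq> []" "qs \<noteq> []" using i ne by (auto simp: ps_def qs_def)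
  moreover have "last ps = xs ! i" using i by (simp add: ps_def take_Suc_conv_app_nth)
  moreover have "hd qs = xs ! Suc i" using i by (simp add: qs_def hd_drop_conv_nth)
  moreover have "path ps" "path (rev qs)" "set ps \<inter> set qs = {}"
    using dist succ xs unfolding path_rev by (auto simp: path_def successively_append_iff)
  ultimately have "closed_path (ps @ rev qs)"
    using i xs assms(2) adj_sym unfolding closed_path_def
    by (auto simp: path_def successively_append_iff hd_rev last_rev)
  moreover have "set (ps @ rev qs) = set xs" by (simp add: xs)
  ultimately show ?thesis unfolding ham_def by blast
qed

text \<open>More than half of the vertices of a cycle cannot avoid being consecutive, and
  \<open>w\<close> fits between two consecutive neighbours.\<close>

lemma ham_insert:
  assumes "ham X" "w \<notin> X" and deg: "card X < 2 * deg X w"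
  shows "ham (insert w X)"
proof -
  obtain xs where cp: "closed_path xs" and X: "set xs = X" using assms by (auto simp: ham_def)
  let ?m = "length xs"
  have dist: "distinct xs" and succ: "successively adj xs" and len: "3 \<le> ?m"
    and cl: "adj (last xs) (hd xs)"
    using cp by (auto simp: closed_path_def path_def)
  have ne: "xs \<noteq> []" using len by auto
  define A where "A = {i. i < ?m \<and> adj w (xs ! i)}"
  have "{v \<in> X. adj w v} = (\<lambda>i. xs ! i) ` A"
    using X by (auto simp: A_def in_set_conv_nth)
  then have "deg X w \<le> card A" by (simp add: deg_def A_def card_image_le)
  then have cA: "?m < 2 * card A" using deg dist X distinct_card by fastforce
  have finA: "finite A" by (simp add: A_def)
  have cS: "card (Suc ` A) = card A" by (simp add: card_image)
  show ?thesis
  \<comment> \<open>The consecutive pair formed by the last and the first vertex is invisible to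
    \<open>Suc\<close> and is treated separately.\<close>
  proof (cases "adj w (hd xs) \<and> adj w (last xs)")
    case True
    then have "closed_path (w # xs)"
      using dist succ len X assms(2) ne adj_sym
      by (cases xs) (auto simp: closed_path_def path_def)
    then show ?thesis using X unfolding ham_def by (metis list.simps(15))
  next
    case False
    then have no: "0 \<notin> A \<or> ?m - 1 \<notin> A"
      using ne by (auto simp: A_def hd_conv_nth last_conv_nth)
    have "A \<inter> Suc ` A \<noteq> {}"
    proof
      assume "A \<inter> Suc ` A = {}"
      then have "card (A \<union> Suc ` A) = 2 * card A" using finA cS by (simp add: card_Un_disjoint)
      \<comment> \<open>As \<open>0\<close> and \<open>?m - 1\<close> are not both in
        \<open>A\<close>, the union with its shift fits into a window of \<open>?m\<close>
        numbers.\<close>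
      moreover have "A \<union> Suc ` A \<subseteq> {..<?m} \<or> A \<union> Suc ` A \<subseteq> {1..?m}"
      proof (cases "0 \<in> A")
        case True
        then have "?m - 1 \<notin> A" using no by simp
        then have "A \<union> Suc ` A \<subseteq> {..<?m}"
          unfolding A_def by (auto intro!: Suc_lessI) (metis One_nat_def diff_Suc_1)
        then show ?thesis ..
      next
        case False
        then have "A \<union> Suc ` A \<subseteq> {1..?m}" by (auto simp: A_def Suc_le_eq intro: gr0I)
        then show ?thesis ..
      qed
      then have "card (A \<union> Suc ` A) \<le> ?m"
        using card_mono[of "{..<?m}" "A \<union> Suc ` A"] card_mono[of "{1..?m}" "A \<union> Suc ` A"] by auto
      ultimately show False using cA by simp
    qed
    then obtain i where i: "Suc i < ?m" "adj w (xs ! i)" "adj w (xs ! Suc i)" by (auto simp: A_def)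
    define ps qs where "ps = take (Suc i) xs" and "qs = drop (Suc i) xs"
    have xs: "xs = ps @ qs" by (simp add: ps_def qs_def)
    have "ps \<noteq> []" "qs \<noteq> []" using i ne by (auto simp: ps_def qs_def)
    moreover have "last ps = xs ! i" using i by (simp add: ps_def take_Suc_conv_app_nth)
    moreover have "hd qs = xs ! Suc i" using i by (simp add: qs_def hd_drop_conv_nth)
    ultimately have "closed_path (ps @ w # qs)"
      using i xs dist succ len cl assms(2) X adj_sym
      by (auto simp: closed_path_def path_def successively_append_iff successively_Cons)
    moreover have "set (ps @ w # qs) = insert w X" using X xs by auto
    ultimately show ?thesis unfolding ham_def by blast
  qed
qed

section \<open>Counting induced edges\<close>

text \<open>Following a path, every vertex outside \<open>X\<close> contributes the edge by which it is entered.\<close>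

lemma path_induced_card:
  assumes "path xs" "xs \<noteq> []" "hd xs \<in> X" "finite X"
  shows "card (induced X) + card (set xs - X) \<le> card (induced (X \<union> set xs))"
  using assms(1-3)
proof (induction xs rule: rev_induct)
  case (snoc v xs)
  show ?case
  proof (cases "xs = []")
    case True
    then show ?thesis using snoc.prems by (simp add: insert_absorb)
  next
    case False
    then have IH: "card (induced X) + card (set xs - X) \<le> card (induced (X \<union> set xs))"
      using snoc by (auto simp: path_def successively_append_iff)
    show ?thesis
    proof (cases "v \<in> X")
      case True
      then have "set (xs @ [v]) - X = set xs - X" "X \<union> set (xs @ [v]) = X \<union> set xs" by auto
      then show ?thesis using IH by simp
    next
      case v: False
      have vx: "v \<notin> set xs" "adj (last xs) v"
        using snoc.prems False by (auto simp: path_def successively_append_iff)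
      have "insert {last xs, v} (induced (X \<union> set xs)) \<subseteq> induced (X \<union> set (xs @ [v]))"
        using vx False by (auto simp: induced_def adj_def)
      moreover have "{last xs, v} \<notin> induced (X \<union> set xs)"
        using v vx by (auto simp: induced_def)
      ultimately have "Suc (card (induced (X \<union> set xs))) \<le> card (induced (X \<union> set (xs @ [v])))"
        using card_mono[OF finite_induced] by (metis card_insert_disjoint finite_induced)
      moreover have "set (xs @ [v]) - X = insert v (set xs - X)" using v by auto
      then have "card (set (xs @ [v]) - X) = Suc (card (set xs - X))" using vx by simp
      ultimately show ?thesis using IH by simp
    qed
  qed
qed simp

text \<open>A Hamiltonian cycle of \<open>Y\<close> is opened at a vertex of \<open>X\<close>; each
  vertex of \<open>Y - X\<close> then brings its own new edge, so the surplus of edges over vertices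
  does not shrink.\<close>

lemma good_superset:
  assumes "good X" "X \<subseteq> Y" "ham Y"
  shows "good Y"
proof -
  have hX: "ham X" and eX: "card X + c \<le> card (induced X)" using assms(1) by (auto simp: good_def)
  obtain p where p: "p \<in> X" using ham_card[OF hX] by fastforce
  then obtain ys where ys: "closed_path (p # ys)" "set (p # ys) = Y"
    using ham_hd[OF assms(3)] assms(2) by blast
  have "card (induced X) + card (set (p # ys) - X) \<le> card (induced (X \<union> set (p # ys)))"
    by (rule path_induced_card) (use p ys ham_finite[OF hX] in \<open>auto simp: closed_path_def\<close>)
  then have "card (induced X) + card (Y - X) \<le> card (induced Y)"
    using ys(2) assms(2) by (metis Un_absorb1)
  moreover have "card (Y - X) + card X = card Y"
    using assms(2) ham_finite[OF assms(3)]
    by (metis card_Diff_subset card_mono finite_subset le_add_diff_inverse2)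
  ultimately show ?thesis using eX assms(3) by (simp add: good_def)
qed

text \<open>Deleting \<open>p\<close> from the cycle leaves a path with \<open>card X - 2\<close>
  edges, to which the \<open>c + 2\<close> edges at \<open>p\<close> are added.\<close>

lemma good_of_deg:
  assumes "ham X" "p \<in> X" "c + 2 \<le> deg X p"
  shows "good X"
proof -
  obtain ys where ys: "closed_path (p # ys)" "set (p # ys) = X" using ham_hd[OF assms(1,2)] .
  have ne: "ys \<noteq> []" and pys: "path ys" "p \<notin> set ys"
    using ys by (auto simp: closed_path_def path_def successively_Cons)
  let ?N = "(\<lambda>q. {p, q}) ` {q \<in> X. adj p q}"
  have "set ys = insert (hd ys) (set ys - {hd ys})" using ne by auto
  then have "Suc (card (set ys - {hd ys})) = card (set ys)"
    by (metis Diff_iff List.finite_set card_insert_disjoint finite_Diff singletonI)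
  moreover have "card (induced {hd ys}) + card (set ys - {hd ys}) \<le> card (induced (set ys))"
    using path_induced_card[OF pys(1) ne, of "{hd ys}"] ne by (simp add: insert_absorb)
  moreover have "card X = Suc (card (set ys))" using ys(2) pys by auto
  moreover have "card ?N = deg X p"
    unfolding deg_def by (rule card_image) (auto simp: inj_on_def doubleton_eq_iff)
  moreover have "card (induced (set ys) \<union> ?N) = card (induced (set ys)) + card ?N"
    by (rule card_Un_disjoint)
       (use finite_induced pys ham_finite[OF assms(1)] in \<open>auto simp: induced_def\<close>)
  moreover have "card (induced (set ys) \<union> ?N) \<le> card (induced X)"
    by (rule card_mono) (use finite_induced ys assms(2) in \<open>auto simp: induced_def adj_def\<close>)
  ultimately show ?thesis using assms by (simp add: good_def)
qed


section \<open>Ore's theorem\<close>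

text \<open>Neither \<open>u\<close> nor \<open>v\<close> is a neighbour of \<open>u\<close> or
  \<open>v\<close>, so all neighbours lie in the smaller set \<open>X - {u, v}\<close>, where the
  pigeonhole is strict.\<close>

lemma common_neighbour_ore:
  assumes "finite X" "u \<in> X" "v \<in> X" "u \<noteq> v" "\<not> adj u v" "card X \<le> deg X u + deg X v"
  obtains z where "z \<in> X" "adj u z" "adj v z"
proof -
  have "{z \<in> X - {u, v}. adj u z} = {z \<in> X. adj u z}" "{z \<in> X - {u, v}. adj v z} = {z \<in> X. adj v z}"
    using assms(5) adj_sym by auto
  then have "deg (X - {u, v}) u = deg X u" "deg (X - {u, v}) v = deg X v" by (simp_all add: deg_def)
  moreover have "card (X - {u, v}) < card X"
    using assms by (intro psubset_card_mono) auto
  ultimately have "card (X - {u, v}) < deg (X - {u, v}) u + deg (X - {u, v}) v"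
    using assms(6) by linarith
  then obtain z where "z \<in> X - {u, v}" "adj u z" "adj v z"
    using common_neighbour[of "X - {u, v}" u v] assms(1) by blast
  then show ?thesis using that by blast
qed

text \<open>All neighbours of the ends of a longest path lie on it, so it closes to a cycle; a
  vertex outside attached to this cycle would give a longer path.\<close>

lemma ham_if_ore:
  assumes "finite X" "3 \<le> card X"
    and ore: "\<And>u v. u \<in> X \<Longrightarrow> v \<in> X \<Longrightarrow> u \<noteq> v \<Longrightarrow> \<not> adj u v \<Longrightarrow> card X \<le> deg X u + deg X v"
  shows "ham X"
proof -
  \<comment> \<open>A path on three vertices ensures that the longest path is long enough to form a
    cycle.\<close>
  have "\<exists>xs. path xs \<and> set xs \<subseteq> X \<and> length xs = 3"
  proof (cases "\<exists>u\<in>X. \<exists>v\<in>X. u \<noteq> v \<and> \<not> adj u v")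
    case True
    then obtain u v where uv: "u \<in> X" "v \<in> X" "u \<noteq> v" "\<not> adj u v" by blast
    then obtain z where "z \<in> X" "adj u z" "adj v z"
      using common_neighbour_ore[OF assms(1) uv] ore[OF uv] by blast
    then have "path [u, z, v] \<and> set [u, z, v] \<subseteq> X \<and> length [u, z, v] = 3"
      using uv adj_sym by (auto simp: path_def)
    then show ?thesis by blast
  next
    case False
    obtain T where T: "T \<subseteq> X" "card T = 3" "finite T"
      using obtain_subset_with_card_n[OF assms(2)] by blast
    then obtain xs where xs: "set xs = T" "distinct xs" using finite_distinct_list by blast
    then have len: "length xs = 3" using T distinct_card by fastforce
    have "adj (xs ! i) (xs ! Suc i)" if "Suc i < length xs" for i
    proof -
      have "xs ! i \<in> X" "xs ! Suc i \<in> X" using that xs T by (auto simp: subset_iff)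
      moreover have "xs ! i \<noteq> xs ! Suc i" using that xs by (simp add: nth_eq_iff_index_eq)
      ultimately show ?thesis using False by blast
    qed
    then have "successively adj xs" by (simp add: successively_conv_nth)
    then show ?thesis using xs T len unfolding path_def by blast
  qed
  then obtain xs0 where xs0: "path xs0" "set xs0 \<subseteq> X" "length xs0 = 3" by blast
  have bound: "length xs \<le> card X" if "path xs" "set xs \<subseteq> X" for xs
    using that assms(1) by (metis card_mono distinct_card path_def)
  obtain xs where xs: "path xs" "set xs \<subseteq> X"
    and max: "\<And>ys. path ys \<Longrightarrow> set ys \<subseteq> X \<Longrightarrow> length ys \<le> length xs"
    using ex_has_greatest_nat[of "\<lambda>xs. path xs \<and> set xs \<subseteq> X" xs0 length "Suc (card X)"] xs0 bound
    by (auto simp: less_Suc_eq_le)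
  have len: "3 \<le> length xs" using max[of xs0] xs0 by simp
  then have ne: "xs \<noteq> []" by auto
  have hd_nb: "v \<in> set xs" if "v \<in> X" "adj (hd xs) v" for v
  proof (rule ccontr)
    assume "v \<notin> set xs"
    then have "path (v # xs)"
      using xs that adj_sym by (auto simp: path_def successively_Cons)
    then show False using max[of "v # xs"] that xs by simp
  qed
  have last_nb: "v \<in> set xs" if "v \<in> X" "adj (last xs) v" for v
  proof (rule ccontr)
    assume "v \<notin> set xs"
    then have "path (xs @ [v])"
      using xs that ne by (auto simp: path_def successively_append_iff)
    then show False using max[of "xs @ [v]"] that xs by simp
  qed
  have "ham (set xs)"
  proof (cases "adj (last xs) (hd xs)")
    case True
    then show ?thesis using xs len unfolding ham_def closed_path_def by blast
  next
    case False
    have "hd xs \<noteq> last xs"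
      using xs len by (cases xs) (auto simp: path_def split: if_splits)
    then have "card X \<le> deg X (hd xs) + deg X (last xs)"
      using ore[of "hd xs" "last xs"] False xs ne adj_sym by (meson hd_in_set last_in_set subsetD)
    moreover have "{v \<in> X. adj (hd xs) v} = {v \<in> set xs. adj (hd xs) v}"
      "{v \<in> X. adj (last xs) v} = {v \<in> set xs. adj (last xs) v}"
      using hd_nb last_nb xs by auto
    ultimately show ?thesis
      using path_crossing[OF xs(1) len] bound[OF xs] by (simp add: deg_def)
  qed
  moreover have "set xs = X"
  proof (rule ccontr)
    assume "set xs \<noteq> X"
    then obtain z where z: "z \<in> X" "z \<notin> set xs" using xs by blast
    \<comment> \<open>If \<open>z\<close> misses the head, a common neighbour of the two lies on the
      path, because every neighbour of the head does.\<close>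
    obtain z' q where zq: "z' \<in> X" "z' \<notin> set xs" "q \<in> set xs" "adj z' q"
    proof (cases "adj z (hd xs)")
      case True
      then show ?thesis using that[of z "hd xs"] z ne by simp
    next
      case False
      moreover have "hd xs \<in> X" "z \<noteq> hd xs" using xs ne z by auto
      ultimately obtain t where "t \<in> X" "adj z t" "adj (hd xs) t"
        using common_neighbour_ore[OF assms(1) z(1), of "hd xs"] ore[OF z(1), of "hd xs"] by blast
      then show ?thesis using that[of z t] z hd_nb by blast
    qed
    obtain ys where "closed_path (q # ys)" "set (q # ys) = set xs"
      using ham_hd[OF \<open>ham (set xs)\<close> zq(3)] .
    then have ys: "path (z' # q # ys)" "set (q # ys) = set xs" "path (q # ys)"
      using zq by (auto simp: closed_path_def path_def)
    then have "length (q # ys) = length xs"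
      using xs by (metis distinct_card path_def)
    then show False using max[OF ys(1)] zq xs ys(2) by auto
  qed
  ultimately show ?thesis by simp
qed

section \<open>Exchanging members of a packing\<close>

lemma packing_insert:
  assumes "packing m D" "good Y" "Y \<subseteq> V" "Y \<inter> \<Union>D = {}"
  shows "packing (Suc m) (insert Y D)"
proof -
  \<comment> \<open>Disjointness from the members rules out \<open>Y \<in> D\<close> only because
    \<open>Y\<close> is nonempty; hence the cardinality really grows.\<close>
  have "Y \<noteq> {}" using assms(2) ham_card by (force simp: good_def)
  then have "Y \<notin> D" using assms(4) by auto
  then show ?thesis
    using assms by (auto simp: packing_def pairwise_insert disjnt_def)
qed

lemma packing_remove:
  assumes "packing m D" "X \<in> D"
  shows "packing (m - 1) (D - {X})" "X \<inter> \<Union>(D - {X}) = {}"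
  using assms by (auto simp: packing_def pairwise_def disjnt_def)

lemma packing_replace:
  assumes "packing m D" "X \<in> D" "good Y" "Y \<subseteq> V" "Y \<inter> \<Union>(D - {X}) = {}"
  shows "packing m (insert Y (D - {X}))"
proof -
  have "0 < m" using assms by (auto simp: packing_def card_gt_0_iff)
  then show ?thesis
    using packing_insert[OF packing_remove(1)[OF assms(1,2)] assms(3-5)] by simp
qed

lemma packing_finite: "packing m D \<Longrightarrow> X \<in> D \<Longrightarrow> finite X"
  by (auto simp: packing_def good_def ham_finite)

text \<open>The basic move that enlarges the covered set: \<open>ham_insert\<close> extends the
  cycle and \<open>good_superset\<close> keeps its chords.\<close>

lemma packing_absorb:
  assumes "packing m D" "X \<in> D" "w \<in> V" "w \<notin> \<Union>D" "card X < 2 * deg X w"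
  shows "packing m (insert (insert w X) (D - {X}))"
proof (rule packing_replace[OF assms(1,2)])
  have gX: "good X" and XV: "X \<subseteq> V" using assms by (auto simp: packing_def)
  have "ham (insert w X)"
    using ham_insert[of X w] gX assms by (auto simp: good_def)
  then show "good (insert w X)" using good_superset[OF gX] by blast
  show "insert w X \<subseteq> V" using XV assms by simp
  show "insert w X \<inter> \<Union>(D - {X}) = {}"
    using packing_remove(2)[OF assms(1,2)] assms(4) by blast
qed

lemma deg_packing:
  assumes "packing m D" "\<Union>D \<subseteq> V"
  shows "deg V u = deg (V - \<Union>D) u + (\<Sum>X\<in>D. deg X u)"
    "card V = card (V - \<Union>D) + (\<Sum>X\<in>D. card X)"
proof -
  have fin: "\<And>X. X \<in> D \<Longrightarrow> finite X" using packing_finite[OF assms(1)] .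
  have D: "finite D" "pairwise disjnt D" using assms by (auto simp: packing_def)
  have fU: "finite (\<Union>D)" using assms(2) finite_V finite_subset by blast
  have V: "(V - \<Union>D) \<union> \<Union>D = V" using assms(2) by blast
  show "deg V u = deg (V - \<Union>D) u + (\<Sum>X\<in>D. deg X u)"
    using deg_Un_disjoint[of "V - \<Union>D" "\<Union>D" u] V finite_V fU deg_Union[OF D fin, of u]
    by (simp add: Int_commute)
  have "card V = card (V - \<Union>D) + card (\<Union>D)"
    using assms(2) finite_V fU by (simp add: card_Diff_subset card_mono)
  moreover have "card (\<Union>D) = (\<Sum>X\<in>D. card X)"
    using D fin by (intro card_Union_disjoint) auto
  ultimately show "card V = card (V - \<Union>D) + (\<Sum>X\<in>D. card X)" by simp
qed


section \<open>Cutting a long path into good segments\<close>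

text \<open>Each end misses at most \<open>d\<close> vertices of the segment, hence sees at least
  half of it and at least \<open>c + 2\<close> vertices. The first closes the segment, the second
  supplies the chords.\<close>

lemma segment_good:
  assumes "path zs" "set zs \<subseteq> V" "c + 2 \<le> d" "2 * d \<le> length zs"
    and large: "card V \<le> deg V (hd zs) + d" "card V \<le> deg V (last zs) + d"
  shows "good (set zs)"
proof -
  have ne: "zs \<noteq> []" and len: "3 \<le> length zs" using assms(3,4) by auto
  have card_zs: "card (set zs) = length zs" using assms(1) by (simp add: path_def distinct_card)
  have seg: "length zs \<le> deg (set zs) v + d" if "card V \<le> deg V v + d" for v
  proof -
    have "deg V v = deg (set zs) v + deg (V - set zs) v"
      using deg_Un_disjoint[of "set zs" "V - set zs" v] finite_V assms(2)
      by (simp add: Un_absorb1)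
    moreover have "deg (V - set zs) v \<le> card V - card (set zs)"
      using deg_le_card[of "V - set zs" v] finite_V assms(2) by (simp add: card_Diff_subset)
    moreover have "card (set zs) \<le> card V" using finite_V assms(2) card_mono by blast
    ultimately show ?thesis using that card_zs by linarith
  qed
  have "ham (set zs)"
    by (rule path_crossing[OF assms(1) len]) (use seg[OF large(1)] seg[OF large(2)] assms(4) in linarith)
  then show ?thesis
    by (rule good_of_deg[of _ "hd zs"]) (use ne seg[OF large(1)] assms(3,4) in auto)
qed

text \<open>A cut at \<open>j\<close> separates positions \<open>j - 1\<close> and \<open>j\<close>,
  so a vertex of \<open>B\<close> at position \<open>p\<close> spoils only the cuts \<open>p\<close>
  and \<open>p + 1\<close>.\<close>

lemma blocked_positions:
  assumes "distinct zs" "1 \<le> s" "t \<le> length zs"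
    and "\<And>j. s \<le> j \<Longrightarrow> j < t \<Longrightarrow> zs ! (j - 1) \<in> B \<or> zs ! j \<in> B"
  shows "t \<le> s + 2 * card (B \<inter> set (take t zs))"
proof -
  define J where "J = {j. j < t \<and> zs ! j \<in> B}"
  have finJ: "finite J" by (simp add: J_def)
  have "{s..<t} \<subseteq> J \<union> Suc ` J"
  proof
    fix j assume j: "j \<in> {s..<t}"
    then obtain i where "j = Suc i" using assms(2) by (cases j) auto
    then show "j \<in> J \<union> Suc ` J" using j assms(4)[of j] by (auto simp: J_def)
  qed
  then have "card {s..<t} \<le> card (J \<union> Suc ` J)" using finJ by (intro card_mono) auto
  also have "\<dots> \<le> card J + card J"
    using card_Un_le[of J "Suc ` J"] by (simp add: card_image)
  finally have "t - s \<le> 2 * card J" by simp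
  moreover have "card J \<le> card (B \<inter> set (take t zs))"
  proof (rule card_inj_on_le)
    show "inj_on ((!) zs) J" using assms(1,3) by (auto simp: inj_on_def J_def nth_eq_iff_index_eq)
    show "(!) zs ` J \<subseteq> B \<inter> set (take t zs)"
    proof
      fix v assume "v \<in> (!) zs ` J"
      then obtain j where j: "j < t" "zs ! j \<in> B" "v = zs ! j" by (auto simp: J_def)
      then have "take t zs ! j \<in> set (take t zs)" using assms(3) by (intro nth_mem) simp
      then show "v \<in> B \<inter> set (take t zs)" using j by simp
    qed
  qed simp
  ultimately show ?thesis by linarith
qed

text \<open>Both ends of a segment have to avoid \<open>B\<close>; every vertex of \<open>B\<close> spoils at most two
  cutting positions, which the summand \<open>2 * card (B \<inter> set zs)\<close> compensates.\<close>

lemma cut_path: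
  assumes "c + 2 \<le> d" "\<And>v. v \<in> V - B \<Longrightarrow> card V \<le> deg V v + d"
    and "path zs" "set zs \<subseteq> V" "hd zs \<notin> B" "last zs \<notin> B"
    and "2 * d * Suc m + 2 * card (B \<inter> set zs) \<le> length zs"
  shows "\<exists>D. packing (Suc m) D \<and> \<Union>D = set zs"
  using assms(3-)
proof (induction m arbitrary: zs)
  case 0
  have "zs \<noteq> []" using 0 assms(1) by auto
  then have "hd zs \<in> V - B" "last zs \<in> V - B" using 0 by auto
  moreover from this have "card V \<le> deg V (hd zs) + d" "card V \<le> deg V (last zs) + d"
    using assms(2) by blast+
  ultimately have "good (set zs)"
    using segment_good[OF 0(1,2) assms(1)] 0(5) by simp
  then have "packing (Suc 0) {set zs}" using 0 by (simp add: packing_def)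
  then show ?case by (intro exI[of _ "{set zs}"]) simp
next
  case (Suc m)
  let ?s = "2 * d"
  define ok where "ok i \<longleftrightarrow> ?s \<le> i \<and> i < length zs \<and> zs ! (i - 1) \<notin> B \<and> zs ! i \<notin> B" for i
  have dist: "distinct zs" using Suc.prems by (simp add: path_def)
  have s1: "1 \<le> ?s" using assms(1) by simp
  have "\<exists>i. ok i"
  proof (rule ccontr)
    assume "\<nexists>i. ok i"
    then have "length zs \<le> ?s + 2 * card (B \<inter> set (take (length zs) zs))"
      by (intro blocked_positions[OF dist s1]) (auto simp: ok_def)
    then show False using Suc.prems(5) s1 by (simp add: algebra_simps)
  qed
  \<comment> \<open>With the first admissible cut, every earlier one from \<open>?s\<close> on is
    blocked. The excess of the first piece over \<open>2 * d\<close> is then paid for by the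
    vertices of \<open>B\<close> that it contains, and the rest still meets the length
    bound.\<close>
  define i where "i = (LEAST i. ok i)"
  have "ok i" unfolding i_def using \<open>\<exists>i. ok i\<close> by (rule LeastI_ex)
  then have i: "?s \<le> i" "i < length zs" "zs ! (i - 1) \<notin> B" "zs ! i \<notin> B" by (auto simp: ok_def)
  have "\<not> ok j" if "j < i" for j using that not_less_Least unfolding i_def by blast
  then have cnt: "i \<le> ?s + 2 * card (B \<inter> set (take i zs))"
    using i by (intro blocked_positions[OF dist s1]) (auto simp: ok_def)
  define ps qs where "ps = take i zs" and "qs = drop i zs"
  have zs: "zs = ps @ qs" by (simp add: ps_def qs_def)
  have len: "length ps = i" "length zs = i + length qs" using i by (auto simp: ps_def qs_def)
  have ne: "ps \<noteq> []" "qs \<noteq> []" using i s1 len by auto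
  have ends: "hd ps = hd zs" "last qs = last zs"
    using ne zs by auto
  have cut: "last ps = zs ! (i - 1)" "hd qs = zs ! i"
    using i(2) len(1) ne s1 i(1) by (auto simp: ps_def qs_def last_conv_nth hd_drop_conv_nth)
  have paths: "path ps" "path qs" "set ps \<inter> set qs = {}"
    using Suc.prems(1) zs by (auto simp: path_def successively_append_iff)
  have sub: "set ps \<subseteq> V" "set qs \<subseteq> V" using Suc.prems(2) zs by auto
  have "B \<inter> set zs = (B \<inter> set ps) \<union> (B \<inter> set qs)" using zs by auto
  then have "card (B \<inter> set zs) = card (B \<inter> set ps) + card (B \<inter> set qs)"
    using paths(3) by (simp add: card_Un_disjoint disjoint_iff)
  then have "2 * d * Suc m + 2 * card (B \<inter> set qs) \<le> length qs"
    using Suc.prems(5) len cnt by (simp add: algebra_simps ps_def)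
  moreover have "hd qs \<notin> B" "last qs \<notin> B" using ends cut i Suc.prems(4) by simp_all
  ultimately obtain D where D: "packing (Suc m) D" "\<Union>D = set qs"
    using Suc.IH[OF paths(2) sub(2)] by blast
  have "hd ps \<in> V - B" "last ps \<in> V - B"
    using ends cut i(3) sub(1) Suc.prems(3) hd_in_set[OF ne(1)] last_in_set[OF ne(1)] by auto
  then have "card V \<le> deg V (hd ps) + d" "card V \<le> deg V (last ps) + d"
    using assms(2) by blast+
  then have "good (set ps)"
    using segment_good[OF paths(1) sub(1) assms(1)] i(1) len(1) by simp
  then have "packing (Suc (Suc m)) (insert (set ps) D)"
    using D paths sub by (intro packing_insert) auto
  moreover have "\<Union>(insert (set ps) D) = set zs" using D zs by auto
  ultimately show ?case by blast
qed

end

section \<open>Absorbing a path under Ore's condition\<close>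

locale ore_graph = graph +
  assumes ore: "u \<in> V \<Longrightarrow> v \<in> V \<Longrightarrow> u \<noteq> v \<Longrightarrow> \<not> adj u v \<Longrightarrow> card V \<le> deg V u + deg V v"
begin

text \<open>The vertices of \<open>us\<close> are handed over one by one to members of the packing, until what is
  left of the path closes up to a cycle. Vertices adjacent to the last vertex of \<open>ts\<close> are never
  handed over, so the hypothesis \<open>2 * deg X (last ts) \<le> card X\<close> is preserved.\<close>

lemma absorb_path:
  assumes "path (us @ ts)" "ts \<noteq> []" "set (us @ ts) \<subseteq> V"
    and "packing m D" "set (us @ ts) \<inter> \<Union>D = {}"
    and "\<And>X. X \<in> D \<Longrightarrow> 2 * deg X (last ts) \<le> card X"
    and "good (set ts) \<or> c + 2 \<le> deg (set us) (last ts)"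
  shows "\<exists>D'. packing (Suc m) D' \<and> \<Union>D \<union> set us \<union> set ts \<subseteq> \<Union>D'"
  using assms
proof (induction us arbitrary: D)
  case Nil
  \<comment> \<open>The degree alternative fails here, since the degree into the empty set is
    0.\<close>
  then have "good (set ts)" by (auto simp: deg_def)
  then have "packing (Suc m) (insert (set ts) D)" using Nil by (intro packing_insert) auto
  then show ?case by (intro exI[of _ "insert (set ts) D"]) auto
next
  case (Cons w us)
  let ?Q = "set (w # us @ ts)"
  define y where "y = last ts"
  have pathQ: "path (w # us @ ts)" and QV: "?Q \<subseteq> V" and QD: "?Q \<inter> \<Union>D = {}"
    and pD: "packing m D" and half: "\<And>X. X \<in> D \<Longrightarrow> 2 * deg X y \<le> card X"
    and cond: "good (set ts) \<or> c + 2 \<le> deg (set (w # us)) y"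
    using Cons.prems by (auto simp: y_def)
  have y: "y \<in> set ts" "last (w # us @ ts) = y" using Cons.prems(2) by (auto simp: y_def)
  have wy: "w \<noteq> y" using pathQ y by (auto simp: path_def)
  have DV: "\<Union>D \<subseteq> V" using pD by (auto simp: packing_def)
  \<comment> \<open>Any Hamiltonian set that contains the remaining path and avoids the packing
    finishes the proof as a new member.\<close>
  have close: ?case if "ham Y" "?Q \<subseteq> Y" "Y \<subseteq> V" "Y \<inter> \<Union>D = {}" for Y
  proof -
    have "good Y" using cond
    proof
      assume "good (set ts)"
      then show "good Y" using good_superset that by auto
    next
      assume "c + 2 \<le> deg (set (w # us)) y"
      also have "\<dots> \<le> deg Y y" using that finite_V by (intro deg_mono) (auto intro: finite_subset)
      finally show "good Y" using good_of_deg[of Y y] that y by auto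
    qed
    then have "packing (Suc m) (insert Y D)" using that pD by (intro packing_insert) auto
    then show ?case using that by (intro exI[of _ "insert Y D"]) auto
  qed
  have cardQ: "card ?Q = length (w # us @ ts)"
    using pathQ unfolding path_def by (metis distinct_card)
  have len: "3 \<le> length (w # us @ ts)" using cond
  proof
    assume "good (set ts)"
    then have "3 \<le> card (set ts)" using ham_card by (simp add: good_def)
    then show ?thesis using card_length[of ts] by simp
  next
    assume "c + 2 \<le> deg (set (w # us)) y"
    also have "\<dots> \<le> length (w # us)"
      using deg_le_card[of "set (w # us)" y] card_length[of "w # us"] by simp
    finally show ?thesis using Cons.prems(2) by (cases ts) auto
  qed
  show ?case
  proof (cases "adj w y")
    case True
    then have "closed_path (w # us @ ts)"
      using pathQ len y adj_sym by (auto simp: closed_path_def)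
    then have "ham ?Q" unfolding ham_def by blast
    then show ?thesis using close QV QD by blast
  next
    case nadj: False
    show ?thesis
    proof (cases "\<exists>z \<in> V - \<Union>D - ?Q. adj w z \<and> adj y z")
      case True
      then obtain z where z: "z \<in> V" "z \<notin> \<Union>D" "z \<notin> ?Q" "adj w z" "adj y z" by blast
      then have "closed_path ((w # us @ ts) @ [z])"
        using pathQ len y adj_sym[of w z] unfolding closed_path_def
        by (simp add: path_def successively_append_iff del: append.simps)
      then have "ham (insert z ?Q)" unfolding ham_def
        by (intro exI[of _ "(w # us @ ts) @ [z]"]) auto
      then show ?thesis using close[of "insert z ?Q"] z QV QD by blast
    next
      case False
      let ?R = "V - \<Union>D"
      have finR: "finite ?R" using finite_V by simp
      \<comment> \<open>Without a common neighbour in this region, its share of the degree sum is at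
        most its size, so Ore's bound carries over to \<open>?Q\<close> together with the members of
        \<open>D\<close>.\<close>
      have "deg (?R - ?Q) w + deg (?R - ?Q) y \<le> card (?R - ?Q)"
      proof (rule ccontr)
        assume "\<not> ?thesis"
        then obtain z where "z \<in> ?R - ?Q" "adj w z" "adj y z"
          using common_neighbour[of "?R - ?Q" w y] finR by auto
        then show False using False by blast
      qed
      moreover have "?Q \<union> (?R - ?Q) = ?R" using QV QD by blast
      then have "deg ?R v = deg ?Q v + deg (?R - ?Q) v" for v
        using deg_Un_disjoint[of ?Q "?R - ?Q" v] finR by simp
      moreover have "card (?R - ?Q) + card ?Q = card ?R"
        using \<open>?Q \<union> (?R - ?Q) = ?R\<close> finR
        by (metis List.finite_set Un_upper1 card_Diff_subset card_mono le_add_diff_inverse2)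
      moreover have "card V \<le> deg V w + deg V y"
        using ore[of w y] nadj wy y QV by auto
      moreover note deg_packing(1)[OF pD DV, of w] deg_packing(1)[OF pD DV, of y]
        deg_packing(2)[OF pD DV]
      ultimately have sum: "card ?Q + (\<Sum>X\<in>D. card X)
          \<le> deg ?Q w + deg ?Q y + (\<Sum>X\<in>D. deg X w + deg X y)"
        by (simp add: sum.distrib)
      show ?thesis
      proof (cases "\<forall>X\<in>D. deg X w + deg X y \<le> card X")
        case True
        then have "(\<Sum>X\<in>D. deg X w + deg X y) \<le> (\<Sum>X\<in>D. card X)" by (intro sum_mono) auto
        then have "length (w # us @ ts) \<le> deg ?Q (hd (w # us @ ts)) + deg ?Q (last (w # us @ ts))"
          using sum cardQ y(2) by simp
        then have "ham ?Q" by (rule path_crossing[OF pathQ len])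
        then show ?thesis using close QV QD by blast
      next
        case False
        then obtain X where X: "X \<in> D" "card X < deg X w + deg X y" by auto
        \<comment> \<open>\<open>y\<close> sees at most half of \<open>X\<close>, so the surplus
          must come from \<open>w\<close>, which can therefore be absorbed by
          \<open>X\<close>.\<close>
        then have big: "card X < 2 * deg X w" using half[of X] by simp
        define D1 where "D1 = insert (insert w X) (D - {X})"
        have U: "\<Union>D1 = insert w (\<Union>D)" using X by (auto simp: D1_def)
        have p1: "packing m D1"
          unfolding D1_def using packing_absorb[OF pD X(1) _ _ big] QV QD by auto
        have nadj': "\<not> adj y w" using nadj adj_sym by blast
        then have eq: "deg (insert w Y) y = deg Y y" for Y
          unfolding deg_def by (rule_tac arg_cong[where f = card]) auto
        have "2 * deg X' y \<le> card X'" if "X' \<in> D1" for X'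
        proof (cases "X' = insert w X")
          case True
          have "card X \<le> card (insert w X)" by (intro card_mono) (use packing_finite[OF pD X(1)] in auto)
          then show ?thesis using half[OF X(1)] True eq[of X] by simp
        next
          case False
          then show ?thesis using that half by (simp add: D1_def)
        qed
        moreover have "path (us @ ts)" "w \<notin> set (us @ ts)"
          using pathQ by (auto simp: path_def successively_Cons)
        moreover have "good (set ts) \<or> c + 2 \<le> deg (set us) y"
          using cond eq[of "set us"] by simp
        ultimately have "\<exists>D'. packing (Suc m) D' \<and> \<Union>D1 \<union> set us \<union> set ts \<subseteq> \<Union>D'"
          using Cons.IH[of D1] Cons.prems(2) QV QD p1 U by (auto simp: y_def)
        then show ?thesis using U by auto
      qed
    qed
  qed
qed


section \<open>A covering packing for at least two cycles\<close>

lemma packing_cover: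
  assumes D0: "packing k D0" and k: "2 \<le> k"
    and n: "2 * (k + 1) * (k * (c + 1) + 2 * c + 1) + 2 \<le> card V"
  shows "\<exists>D. packing k D \<and> \<Union>D = V"
proof -
  have cover_sub: "\<Union>D \<subseteq> V" if "packing k D" for D using that by (auto simp: packing_def)
  obtain D where D: "packing k D"
    and max: "\<And>D'. packing k D' \<Longrightarrow> card (\<Union>D') \<le> card (\<Union>D)"
    using ex_has_greatest_nat[of "packing k" D0 "\<lambda>D. card (\<Union>D)" "Suc (card V)"] D0
      cover_sub card_mono[OF finite_V] by (auto simp: less_Suc_eq_le)
  have DV: "\<Union>D \<subseteq> V" using D cover_sub by blast
  have no_larger: False if "packing k D'" "\<Union>D \<subset> \<Union>D'" for D'
  proof -
    have "card (\<Union>D) < card (\<Union>D')"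
      using finite_subset[OF cover_sub[OF that(1)] finite_V] that(2) by (rule psubset_card_mono)
    then show False using max[OF that(1)] by simp
  qed
  define H where "H = V - \<Union>D"
  have finH: "finite H" and HV: "H \<subseteq> V" using finite_V by (auto simp: H_def)
  have half: "2 * deg X y \<le> card X" if "y \<in> H" "X \<in> D" for y X
  proof (rule ccontr)
    assume "\<not> ?thesis"
    then have "packing k (insert (insert y X) (D - {X}))"
      using packing_absorb[OF D that(2), of y] that(1) by (auto simp: H_def)
    moreover have "\<Union>D \<subset> \<Union>(insert (insert y X) (D - {X}))"
      using that by (auto simp: H_def)
    ultimately show False by (rule no_larger)
  qed
  \<comment> \<open>Taking \<open>X\<close> out leaves \<open>k - 1\<close> members;
    \<open>absorb_path\<close> restores the number \<open>k\<close> while covering all of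
    \<open>X\<close> and also \<open>ts\<close>, against maximality.\<close>
  have no_path: False
    if "path (us @ ts)" "X \<in> D" "set us = X" "set ts \<subseteq> H" "ts \<noteq> []"
      and "good (set ts) \<or> c + 2 \<le> deg X (last ts)" for us ts X
  proof -
    have XU: "X \<inter> \<Union>(D - {X}) = {}" using packing_remove(2)[OF D that(2)] .
    have "\<exists>D'. packing (Suc (k - 1)) D' \<and> \<Union>(D - {X}) \<union> set us \<union> set ts \<subseteq> \<Union>D'"
    proof (rule absorb_path[OF that(1,5) _ packing_remove(1)[OF D that(2)]])
      show "set (us @ ts) \<subseteq> V" using that HV DV by auto
      show "set (us @ ts) \<inter> \<Union>(D - {X}) = {}" using that XU by (auto simp: H_def)
      show "2 * deg Y (last ts) \<le> card Y" if "Y \<in> D - {X}" for Y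
        using half[of "last ts" Y] that last_in_set[OF \<open>ts \<noteq> []\<close>] \<open>set ts \<subseteq> H\<close> by blast
      show "good (set ts) \<or> c + 2 \<le> deg (set us) (last ts)" using that by simp
    qed
    then obtain D' where D': "packing k D'" "\<Union>(D - {X}) \<union> X \<union> set ts \<subseteq> \<Union>D'"
      using k \<open>set us = X\<close> by auto
    moreover have "hd ts \<in> set ts" "hd ts \<notin> \<Union>D"
      using hd_in_set[OF \<open>ts \<noteq> []\<close>] \<open>set ts \<subseteq> H\<close> unfolding H_def by blast+
    ultimately have "\<Union>D \<subset> \<Union>D'" by blast
    then show False using no_larger D'(1) by blast
  qed
  \<comment> \<open>Otherwise the cycle on \<open>X\<close>, opened at a neighbour of
    \<open>y\<close> and continued to \<open>y\<close>, is a forbidden path.\<close>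
  have few: "deg X y \<le> c + 1" if "y \<in> H" "X \<in> D" for y X
  proof (rule ccontr)
    assume gt: "\<not> ?thesis"
    then have "{v \<in> X. adj y v} \<noteq> {}" unfolding deg_def by (metis card.empty zero_le)
    then obtain a where a: "a \<in> X" "adj y a" by blast
    have "ham X" using D that(2) by (auto simp: packing_def good_def)
    then obtain xs where xs: "closed_path (xs @ [a])" "set (xs @ [a]) = X"
      using ham_last a(1) by blast
    have "y \<notin> X" using that by (auto simp: H_def)
    then have "path ((xs @ [a]) @ [y])"
      using xs a(2) adj_sym by (auto simp: closed_path_def path_def successively_append_iff)
    then show False by (rule no_path[OF _ that(2) xs(2)]) (use that(1) gt in auto)
  qed
  have split_deg: "deg V u = deg H u + (\<Sum>X\<in>D. deg X u)"
    and split_card: "card V = card H + (\<Sum>X\<in>D. card X)" for u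
    unfolding H_def by (rule deg_packing[OF D DV])+
  \<comment> \<open>By \<open>half\<close>, each member \<open>X\<close> takes at most
    \<open>card X\<close> of the degree sum, which leaves at least \<open>card H\<close> for
    \<open>H\<close>.\<close>
  have oreH: "card H \<le> deg H u + deg H v" if "u \<in> H" "v \<in> H" "u \<noteq> v" "\<not> adj u v" for u v
  proof -
    have half_sum: "(\<Sum>X\<in>D. deg X u) * 2 \<le> (\<Sum>X\<in>D. card X)" if "u \<in> H" for u
      unfolding sum_distrib_right using half[OF that] by (intro sum_mono) (simp add: mult.commute)
    have "card V \<le> deg V u + deg V v" using ore[OF _ _ that(3,4)] that(1,2) HV by blast
    then show ?thesis
      using half_sum[OF that(1)] half_sum[OF that(2)] split_deg[of u] split_deg[of v] split_card
      by linarith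
  qed
  consider "H = {}" | "2 * c + 3 \<le> card H" | "H \<noteq> {}" "card H \<le> 2 * c + 2" by linarith
  then show ?thesis
  proof cases
    case 1
    then show ?thesis using D DV by (auto simp: H_def)
  next
    case 2
    have hamH: "ham H" using 2 by (intro ham_if_ore finH oreH) auto
    \<comment> \<open>If all degrees were at most \<open>c + 1\<close>, nonadjacent vertices would
      have sum at most \<open>2 * c + 2 < card H\<close>. Then \<open>H\<close> would be complete,
      with degrees far above \<open>c + 1\<close>.\<close>
    have "\<exists>p\<in>H. c + 2 \<le> deg H p"
    proof (rule ccontr)
      assume "\<not> ?thesis"
      then have small: "deg H p \<le> c + 1" if "p \<in> H" for p using that by force
      then have "adj u v" if "u \<in> H" "v \<in> H" "u \<noteq> v" for u v
        using oreH[OF that] small[OF that(1)] small[OF that(2)] 2 by linarith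
      moreover obtain p where "p \<in> H" using 2 by fastforce
      ultimately have "H - {p} \<subseteq> {v \<in> H. adj p v}" by auto
      then have "card (H - {p}) \<le> deg H p" unfolding deg_def using finH by (intro card_mono) auto
      then show False using small[OF \<open>p \<in> H\<close>] \<open>p \<in> H\<close> 2 by simp
    qed
    then have goodH: "good H" using good_of_deg[OF hamH] by blast
    obtain x0 where x0: "x0 \<in> H" using 2 by fastforce
    obtain X0 where X0: "X0 \<in> D" using D k by (force simp: packing_def)
    then have "ham X0" using D by (auto simp: packing_def good_def)
    then obtain b where b: "b \<in> X0" using ham_card by fastforce
    \<comment> \<open>An edge between \<open>H\<close> and the covered part: if \<open>x0\<close>
      and \<open>b\<close> are not adjacent, the path through a common neighbour crosses from one
      side to the other.\<close>
    obtain x a where xa: "x \<in> H" "a \<in> \<Union>D" "adj x a"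
    proof (cases "adj x0 b")
      case True
      then show ?thesis using that x0 X0 b by blast
    next
      case False
      moreover have "x0 \<in> V" "b \<in> V" "x0 \<noteq> b" using x0 X0 b DV by (auto simp: H_def)
      ultimately obtain t where t: "t \<in> V" "adj x0 t" "adj b t"
        using common_neighbour_ore[OF finite_V, of x0 b] ore[of x0 b] by blast
      show ?thesis
      proof (cases "t \<in> H")
        case True
        then show ?thesis using that[of t b] t X0 b adj_sym by blast
      next
        case False
        then show ?thesis using that[of x0 t] t x0 by (auto simp: H_def)
      qed
    qed
    obtain X where X: "X \<in> D" "a \<in> X" using xa(2) by blast
    then have "ham X" using D by (auto simp: packing_def good_def)
    then obtain xs where xs: "closed_path (xs @ [a])" "set (xs @ [a]) = X"
      using ham_last X(2) by blast
    obtain ys where ys: "closed_path (x # ys)" "set (x # ys) = H" using ham_hd[OF hamH xa(1)] .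
    have "X \<inter> H = {}" using X by (auto simp: H_def)
    then have "set (xs @ [a]) \<inter> set (x # ys) = {}" using xs(2) ys(2) by simp
    moreover have "adj (last (xs @ [a])) (hd (x # ys))" using xa(3) adj_sym by simp
    ultimately have "path ((xs @ [a]) @ (x # ys))"
      using xs(1) ys(1) unfolding closed_path_def path_def successively_append_iff distinct_append
      by blast
    then have False by (rule no_path[OF _ X(1) xs(2)]) (use ys goodH in auto)
    then show ?thesis ..
  next
    case 3
    then obtain y where y: "y \<in> H" by blast
    \<comment> \<open>The \<open>k\<close> members contribute at most \<open>c + 1\<close>
      neighbours of \<open>y\<close> each, and \<open>H\<close> at most
      \<open>2 * c + 1\<close>.\<close>
    define d where "d = k * (c + 1) + 2 * c + 1"
    have "(\<Sum>X\<in>D. deg X y) \<le> card D * (c + 1)"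
      using sum_bounded_above[of D "\<lambda>X. deg X y" "c + 1"] few[OF y] by simp
    moreover have "deg H y < card H" using deg_less_card[OF finH y] .
    ultimately have dy: "deg V y \<le> d"
      using split_deg[of y] 3 D by (simp add: d_def packing_def)
    \<comment> \<open>Outside \<open>B\<close> Ore's condition applies against \<open>y\<close>, so
      the small degree of \<open>y\<close> forces large degrees there.\<close>
    define B where "B = insert y {v \<in> V. adj y v}"
    have B: "card B \<le> d + 1" "finite B"
      using dy finite_V unfolding B_def deg_def
      by (auto simp: card_insert_if)
    have high: "card V \<le> deg V v + d" if "v \<in> V - B" for v
      using ore[of y v] that y HV dy by (auto simp: B_def)
    have d2: "c + 2 \<le> d"
    proof -
      have "1 * (c + 1) \<le> k * (c + 1)" using k by (intro mult_le_mono1) simp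
      then show ?thesis by (simp add: d_def)
    qed
    \<comment> \<open>Room for \<open>k\<close> segments of length \<open>2 * d\<close> and two
      spoiled cuts for each of the at most \<open>d + 1\<close> vertices of
      \<open>B\<close>.\<close>
    have nd: "2 * d * k + 2 * (d + 1) \<le> card V"
      using n unfolding d_def[symmetric] by (simp add: algebra_simps)
    then have "ham V" using d2 ore by (intro ham_if_ore finite_V) auto
    then obtain zs where zs: "closed_path zs" "set zs = V" by (auto simp: ham_def)
    have dist: "distinct zs" using zs by (simp add: closed_path_def path_def)
    then have len: "length zs = card V" using zs distinct_card by metis
    \<comment> \<open>The Hamiltonian cycle is opened between two consecutive vertices outside
      \<open>B\<close>, so that both ends of the resulting path are admissible.\<close>
    have "\<exists>i. 1 \<le> i \<and> i < length zs \<and> zs ! (i - 1) \<notin> B \<and> zs ! i \<notin> B"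
    proof (rule ccontr)
      assume "\<not> ?thesis"
      then have "length zs \<le> 1 + 2 * card (B \<inter> set (take (length zs) zs))"
        by (intro blocked_positions[OF dist]) auto
      moreover have "card (B \<inter> set (take (length zs) zs)) \<le> d + 1"
        using B card_mono[of B "B \<inter> set (take (length zs) zs)"] by auto
      ultimately have "card V \<le> 2 * d + 3" using len by simp
      moreover have "4 \<le> 2 * d * k" using d2 k mult_le_mono[of 2 d 2 k] by simp
      ultimately show False using nd by simp
    qed
    then obtain i where i: "1 \<le> i" "i < length zs" "zs ! (i - 1) \<notin> B" "zs ! i \<notin> B" by blast
    define qs where "qs = drop i zs @ take i zs"
    have "closed_path qs"
      using closed_path_rotate[of "take i zs" "drop i zs"] zs by (simp add: qs_def)
    then have "path qs" by (simp add: closed_path_def)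
    moreover have "set qs = V" using zs set_append[of "take i zs" "drop i zs"] by (auto simp: qs_def)
    moreover have "length qs = card V" using len by (simp add: qs_def)
    moreover have "hd qs = zs ! i" "last qs = zs ! (i - 1)"
      using i by (auto simp: qs_def hd_append hd_drop_conv_nth last_append last_conv_nth)
    moreover have "card (B \<inter> V) \<le> d + 1" using B card_mono[of B "B \<inter> V"] by auto
    ultimately have "\<exists>D. packing (Suc (k - 1)) D \<and> \<Union>D = set qs"
      using i nd k by (intro cut_path[OF d2 high]) auto
    then show ?thesis using \<open>set qs = V\<close> k by simp
  qed
qed

end

section \<open>The numerical bound\<close>

text \<open>For \<open>k = c = 1\<close> the inequality fails (22 against 17), one reason to treat a
  single cycle separately.\<close>

lemma f_bound_ge:
  assumes "2 \<le> k" "1 \<le> c"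
  shows "2 * (k + 1) * (k * (c + 1) + 2 * c + 1) + 2 \<le> f_bound k c"
proof -
  obtain a where k: "k = a + 2" using assms(1) by (metis add.commute le_Suc_ex)
  obtain b where c: "c = b + 1" using assms(2) by (metis add.commute le_Suc_ex)
  \<comment> \<open>Moving \<open>4 * k\<close> to the left avoids truncated subtraction; in terms
    of \<open>a\<close> and \<open>b\<close> the difference of the sides has only nonnegative
    coefficients.\<close>
  have "2 * (k + 1) * (k * (c + 1) + 2 * c + 1) + 2 + 4 * k \<le> 8 * k^2 * c + 10 * k * c + 2 * c + 1"
    unfolding k c by (simp add: algebra_simps power2_eq_square)
  then show ?thesis unfolding f_bound_def by linarith
qed

section \<open>Translation between cycle lists and packings\<close>

context graph
begin

lemma card_cycle_edges:
  assumes "distinct C" "3 \<le> length C"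
  shows "card (cycle_edges C) = length C"
proof -
  let ?m = "length C"
  have "inj_on (\<lambda>i. {C ! i, C ! ((i + 1) mod ?m)}) {..<?m}"
  proof (rule inj_onI)
    fix i j assume ij: "i \<in> {..<?m}" "j \<in> {..<?m}"
      and eq: "{C ! i, C ! ((i + 1) mod ?m)} = {C ! j, C ! ((j + 1) mod ?m)}"
    have nth: "C ! a = C ! b \<longleftrightarrow> a = b" if "a < ?m" "b < ?m" for a b
      using assms that by (simp add: nth_eq_iff_index_eq)
    have "0 < ?m" using assms by linarith
    then have "(i + 1) mod ?m < ?m" "(j + 1) mod ?m < ?m" by (rule mod_less_divisor)+
    \<comment> \<open>In the second alternative each index is the cyclic successor of the other,
      which a length of at least 3 excludes.\<close>
    then have "i = j \<or> (i = (j + 1) mod ?m \<and> (i + 1) mod ?m = j)"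
      using eq ij by (auto simp: doubleton_eq_iff nth)
    then show "i = j"
      using ij assms by (auto simp: mod_Suc split: if_splits)
  qed
  moreover have "cycle_edges C = (\<lambda>i. {C ! i, C ! ((i + 1) mod ?m)}) ` {..<?m}"
    by (auto simp: cycle_edges_def)
  ultimately show ?thesis by (simp add: card_image)
qed

lemma is_cycle_iff: "is_cycle V E C \<longleftrightarrow> closed_path C \<and> set C \<subseteq> V"
proof (cases "distinct C \<and> 3 \<le> length C")
  case True
  let ?m = "length C"
  have ne: "C \<noteq> []" using True by auto
  have "cycle_edges C \<subseteq> E \<longleftrightarrow> (\<forall>i<?m. adj (C ! i) (C ! ((i + 1) mod ?m)))"
    by (auto simp: cycle_edges_def adj_def)
  \<comment> \<open>Only the index \<open>?m - 1\<close> wraps around; it gives the closing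
    edge.\<close>
  also have "\<dots> \<longleftrightarrow> (\<forall>i. Suc i < ?m \<longrightarrow> adj (C ! i) (C ! Suc i)) \<and> adj (C ! (?m - 1)) (C ! 0)"
  proof (intro iffI conjI allI impI)
    assume *: "\<forall>i<?m. adj (C ! i) (C ! ((i + 1) mod ?m))"
    show "adj (C ! i) (C ! Suc i)" if "Suc i < ?m" for i using *[rule_format, of i] that by simp
    show "adj (C ! (?m - 1)) (C ! 0)" using *[rule_format, of "?m - 1"] ne by simp
  next
    fix i assume *: "(\<forall>i. Suc i < ?m \<longrightarrow> adj (C ! i) (C ! Suc i)) \<and> adj (C ! (?m - 1)) (C ! 0)"
      and "i < ?m"
    then consider "Suc i < ?m" | "i = ?m - 1" "(i + 1) mod ?m = 0"
      by (metis Suc_eq_plus1 Suc_lessI diff_Suc_1 mod_self)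
    then show "adj (C ! i) (C ! ((i + 1) mod ?m))" using * by cases simp_all
  qed
  finally show ?thesis
    using True ne
    by (auto simp: is_cycle_def closed_path_def path_def successively_conv_nth hd_conv_nth last_conv_nth)
next
  case False
  then show ?thesis by (auto simp: is_cycle_def closed_path_def path_def)
qed

text \<open>The chords are the induced edges without the \<open>length C\<close> cycle edges, so
  their number depends on \<open>set C\<close> alone.\<close>

lemma c_chorded_cycle_iff:
  "c_chorded_cycle c V E C \<longleftrightarrow>
     closed_path C \<and> set C \<subseteq> V \<and> card (set C) + c \<le> card (induced (set C))"
proof (cases "closed_path C \<and> set C \<subseteq> V")
  case True
  then have dist: "distinct C" "3 \<le> length C" and cyc: "is_cycle V E C"
    using is_cycle_iff by (auto simp: closed_path_def path_def)
  have "cycle_edges C \<subseteq> induced (set C)"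
  proof
    fix e assume e: "e \<in> cycle_edges C"
    then obtain i where i: "i < length C" "e = {C ! i, C ! ((i + 1) mod length C)}"
      by (auto simp: cycle_edges_def)
    then have "(i + 1) mod length C < length C" by (intro mod_less_divisor) linarith
    then have "e \<subseteq> set C" using i by simp
    then show "e \<in> induced (set C)" using cyc e by (auto simp: is_cycle_def induced_def)
  qed
  then have "card (chords E C) = card (induced (set C)) - length C"
    "card (cycle_edges C) \<le> card (induced (set C))"
    using card_cycle_edges[OF dist] finite_induced[of "set C"]
    by (simp_all add: chords_def induced_def[symmetric] card_Diff_subset finite_subset card_mono)
       (metis card_mono)
  then show ?thesis
    using True cyc card_cycle_edges[OF dist] distinct_card[OF dist(1)]
    by (auto simp: c_chorded_cycle_def)
qed (auto simp: c_chorded_cycle_def is_cycle_iff)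

lemma packing_of_cycles:
  assumes "disjoint_chorded_cycles k c V E Cs"
  shows "packing k (set ` set Cs)"
proof -
  have len: "length Cs = k" and ch: "\<And>i. i < k \<Longrightarrow> c_chorded_cycle c V E (Cs ! i)"
    and disj: "\<And>i j. i < k \<Longrightarrow> j < k \<Longrightarrow> i \<noteq> j \<Longrightarrow> set (Cs ! i) \<inter> set (Cs ! j) = {}"
    using assms by (auto simp: disjoint_chorded_cycles_def)
  have img: "set ` set Cs = (\<lambda>i. set (Cs ! i)) ` {..<k}"
    using len by (auto simp: set_conv_nth)
  \<comment> \<open>Disjoint nonempty vertex sets are distinct, so passing from the list to a set
    loses no cycle.\<close>
  have "inj_on (\<lambda>i. set (Cs ! i)) {..<k}"
  proof (rule inj_onI)
    fix i j assume "i \<in> {..<k}" "j \<in> {..<k}" "set (Cs ! i) = set (Cs ! j)"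
    moreover from this have "set (Cs ! i) \<noteq> {}"
      using ch[of i] by (auto simp: c_chorded_cycle_def is_cycle_def)
    ultimately show "i = j" using disj[of i j] by auto
  qed
  then have "card (set ` set Cs) = k" unfolding img by (simp add: card_image)
  moreover have "pairwise disjnt (set ` set Cs)"
    unfolding img using disj by (auto simp: pairwise_def disjnt_def)
  moreover have "good X \<and> X \<subseteq> V" if "X \<in> set ` set Cs" for X
    using that ch unfolding img by (auto simp: c_chorded_cycle_iff good_def ham_def)
  ultimately show ?thesis by (simp add: packing_def)
qed

lemma cycles_of_packing:
  assumes "packing k D"
  shows "\<exists>Cs. disjoint_chorded_cycles k c V E Cs \<and> (\<Union>C\<in>set Cs. set C) = \<Union>D"
proof -
  obtain Xs where Xs: "set Xs = D" "distinct Xs" "length Xs = k"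
    using assms finite_distinct_list distinct_card unfolding packing_def by metis
  have "\<exists>C. c_chorded_cycle c V E C \<and> set C = X" if "X \<in> D" for X
    using assms that by (auto simp: packing_def good_def ham_def c_chorded_cycle_iff)
  then obtain F where F: "\<And>X. X \<in> D \<Longrightarrow> c_chorded_cycle c V E (F X) \<and> set (F X) = X" by metis
  have "set (F (Xs ! i)) \<inter> set (F (Xs ! j)) = {}" if "i < k" "j < k" "i \<noteq> j" for i j
  proof -
    have "Xs ! i \<in> D" "Xs ! j \<in> D" "Xs ! i \<noteq> Xs ! j"
      using that Xs by (auto simp: nth_eq_iff_index_eq)
    then show ?thesis using F assms by (auto simp: packing_def pairwise_def disjnt_def)
  qed
  then have "disjoint_chorded_cycles k c V E (map F Xs)"
    using F Xs by (auto simp: disjoint_chorded_cycles_def)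
  moreover have "(\<Union>C\<in>set (map F Xs). set C) = \<Union>D" using F Xs by auto
  ultimately show ?thesis by blast
qed

end

section \<open>From \<open>sigma2\<close> to Ore's condition, and the conclusion\<close>

lemma ore_graph_if_sigma2:
  assumes "simple_graph V E" "enat (card V) \<le> sigma2 V E"
  shows "ore_graph V E"
proof -
  interpret graph V E by unfold_locales (rule assms(1))
  show ?thesis
  proof unfold_locales
    fix u v assume uv: "u \<in> V" "v \<in> V" "u \<noteq> v" "\<not> adj u v"
    let ?S = "{enat (degree V E u + degree V E v) | u v. u \<in> V \<and> v \<in> V \<and> u \<noteq> v \<and> {u, v} \<notin> E}"
    have "?S \<subseteq> (\<lambda>(u, v). enat (degree V E u + degree V E v)) ` (V \<times> V)" by auto
    then have "finite ?S" using finite_V by (meson finite_SigmaI finite_imageI finite_subset)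
    moreover have "enat (degree V E u + degree V E v) \<in> ?S" using uv by (auto simp: adj_def)
    ultimately have "Min ?S \<le> enat (degree V E u + degree V E v)" by (rule Min_le)
    moreover have "sigma2 V E = Min ?S" using uv unfolding sigma2_def by (auto simp: adj_def)
    ultimately have "enat (card V) \<le> enat (degree V E u + degree V E v)"
      using assms(2) by (metis order_trans)
    then show "card V \<le> deg V u + deg V v" by (simp add: deg_def degree_def adj_def)
  qed
qed

theorem theorem2:
  fixes V :: "'a set" and E :: "'a set set" and k c :: nat
  assumes "simple_graph V E"
    and "k \<ge> 1" and "c \<ge> 1"
    and "card V \<ge> f_bound k c"
    and "\<exists>Cs. disjoint_chorded_cycles k c V E Cs"
    and "sigma2 V E \<ge> enat (card V)"
  shows "\<exists>Cs. disjoint_chorded_cycles k c V E Cs \<and> (\<Union>C\<in>set Cs. set C) = V"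
proof -
  interpret ore_graph V E c using ore_graph_if_sigma2 assms(1,6) .
  obtain D0 where D0: "packing k D0" using assms(5) packing_of_cycles by blast
  have "\<exists>D. packing k D \<and> \<Union>D = V"
  proof (cases "k = 1")
    \<comment> \<open>The given cycle ensures at least three vertices, so \<open>V\<close> is
      Hamiltonian by Ore's theorem and inherits the chords as a superset of
      \<open>X\<close>.\<close>
    case True
    then obtain X where "D0 = {X}" using D0 by (auto simp: packing_def card_1_singleton_iff)
    then have X: "good X" "X \<subseteq> V" using D0 by (auto simp: packing_def)
    then have "3 \<le> card X" using ham_card by (auto simp: good_def)
    also have "\<dots> \<le> card V" using X(2) finite_V by (rule card_mono[rotated])
    finally have "ham V" using ore by (intro ham_if_ore finite_V)
    then have "packing k {V}"
      using good_superset[OF X] True by (simp add: packing_def)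
    then show ?thesis by (intro exI[of _ "{V}"]) simp
  next
    case False
    then have "2 \<le> k" using assms(2) by simp
    moreover from this have "2 * (k + 1) * (k * (c + 1) + 2 * c + 1) + 2 \<le> card V"
      using f_bound_ge[of k c] assms(3,4) by (meson order_trans)
    ultimately show ?thesis using packing_cover[OF D0] by blast
  qed
  then show ?thesis using cycles_of_packing by metis
qed

end
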